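(* Suppose that the matrices $P(t)$ are given by $P(t)=P(G(t))$, where $G'\mapsto P(G')$ is a map assigning to each spanning subgraph $G'=(V,E')\in\mathcal{S}(G)$ a real $n\times n$ matrix $P(G')=(p_{ij}(G'))$ such that: (i) $p_{ij}(G')\in[0,1]$ for all $i,j\in V$, $\sum_{j=1}^n p_{ij}(G')=1$ for all $i\in V$, and $p_{ij}(G')\ne 0$ if and only if $j=i$ or $(i,j)\in E'$; (ii) $P(G')$ is invertible. Then for almost all (with respect to Lebesgue measure on $\mathbb{R}^n$) vectors of initial opinions $x^0\in\mathbb{R}^n$, the following holds: if the trajectory starting from $x^0$ satisfies the fast convergence assumption, then any two agents $i,j\in V$ asymptotically agree if and only if they are asymptotically connected.
   Context: Opinion dynamics with decaying confidence. Let $V=\{1,\dots,n\}$ be a finite set of agents and $E\subseteq V\times V$ a symmetric, anti-reflexive relation, so that $G=(V,E)$ is an undirected graph. $\mathcal{S}(G)$ denotes the (finite) set of spanning subgraphs $G'=(V,E')$ of $G$, with $E'\subseteq E$ symmetric. Let $R>0$ and $\rho\in(0,1)$ be parameters. Given a vector of initial opinions $x^0\in\mathbb{R}^n$, the vector of opinions $x(t)=(x_1(t),\dots,x_n(t))^\top$, $t\in\mathbb{N}=\{0,1,2,\dots\}$, is defined by $x(0)=x^0$ and $$x(t+1)=P(t)x(t),\qquad P(t)=P(G(t)),$$ where $G(t)=(V,E(t))$ is the interaction graph at time $t$, with $$E(t)=\{(i,j)\in E\mid |x_i(t)-x_j(t)|\le R\rho^t\}$$ (so $G(t)$, and hence $P(t)$,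 depends on $x(t)$ and $t$). Under condition (i), each sequence $(x_i(t))_{t\in\mathbb{N}}$ converges; its limit is denoted $x_i^*$. Agents $i,j$ asymptotically agree if $x_i^*=x_j^*$. Let $E^\infty=\{(i,j)\in E\mid \forall t\in\mathbb{N},\ \exists s\ge t,\ (i,j)\in E(s)\}$ and $G^\infty=(V,E^\infty)$ (depending on $x^0$). Agents $i,j$ are asymptotically connected if they are connected by a path in $G^\infty$ (a vertex being regarded as connected to itself). Fast convergence assumption (for a trajectory): there exist $\underline{\rho}<\rho$ and $M\ge 0$ such that for all $i\in V$ and all $t\in\mathbb{N}$, $|x_i(t)-x_i^*|\le M\underline{\rho}^t$. *)

theory Defs
  imports "HOL-Analysis.Analysis"
begin

text \<open>
  The set of agents is the finite type \<open>'n\<close>, so that opinion vectors are elements of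
  \<open>real ^ 'n\<close>. As all graphs have the full vertex set, a graph is represented by its edge relation.
\<close>

definition spanning_subgraphs :: "('n \<times> 'n) set \<Rightarrow> ('n \<times> 'n) set set" where
  "spanning_subgraphs E = {E'. E' \<subseteq> E \<and> sym E'}"

definition interaction_edges ::
  "('n \<times> 'n) set \<Rightarrow> real \<Rightarrow> real \<Rightarrow> nat \<Rightarrow> real ^ 'n \<Rightarrow> ('n \<times> 'n) set" where
  "interaction_edges E R \<rho> t y = {(i, j). (i, j) \<in> E \<and> \<bar>y $ i - y $ j\<bar> \<le> R * \<rho> ^ t}"

primrec opinion ::
  "('n::finite \<times> 'n) set \<Rightarrow> real \<Rightarrow> real \<Rightarrow> (('n \<times> 'n) set \<Rightarrow> real ^ 'n ^ 'n) \<Rightarrow>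
    real ^ 'n \<Rightarrow> nat \<Rightarrow> real ^ 'n" where
  "opinion E R \<rho> P x0 0 = x0"
| "opinion E R \<rho> P x0 (Suc t) =
    P (interaction_edges E R \<rho> t (opinion E R \<rho> P x0 t)) *v opinion E R \<rho> P x0 t"

definition opinion_limit ::
  "('n::finite \<times> 'n) set \<Rightarrow> real \<Rightarrow> real \<Rightarrow> (('n \<times> 'n) set \<Rightarrow> real ^ 'n ^ 'n) \<Rightarrow>
    real ^ 'n \<Rightarrow> 'n \<Rightarrow> real" where
  "opinion_limit E R \<rho> P x0 i = lim (\<lambda>t. opinion E R \<rho> P x0 t $ i)"

definition asymptotically_agree ::
  "('n::finite \<times> 'n) set \<Rightarrow> real \<Rightarrow> real \<Rightarrow> (('n \<times> 'n) set \<Rightarrow> real ^ 'n ^ 'n) \<Rightarrow>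
    real ^ 'n \<Rightarrow> 'n \<Rightarrow> 'n \<Rightarrow> bool" where
  "asymptotically_agree E R \<rho> P x0 i j \<longleftrightarrow> opinion_limit E R \<rho> P x0 i = opinion_limit E R \<rho> P x0 j"

definition edges_at ::
  "('n::finite \<times> 'n) set \<Rightarrow> real \<Rightarrow> real \<Rightarrow> (('n \<times> 'n) set \<Rightarrow> real ^ 'n ^ 'n) \<Rightarrow>
    real ^ 'n \<Rightarrow> nat \<Rightarrow> ('n \<times> 'n) set" where
  "edges_at E R \<rho> P x0 t = interaction_edges E R \<rho> t (opinion E R \<rho> P x0 t)"

definition edges_infinity ::
  "('n::finite \<times> 'n) set \<Rightarrow> real \<Rightarrow> real \<Rightarrow> (('n \<times> 'n) set \<Rightarrow> real ^ 'n ^ 'n) \<Rightarrow>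
    real ^ 'n \<Rightarrow> ('n \<times> 'n) set" where
  "edges_infinity E R \<rho> P x0 = {(i, j). (i, j) \<in> E \<and> (\<forall>t. \<exists>s\<ge>t. (i, j) \<in> edges_at E R \<rho> P x0 s)}"

definition asymptotically_connected ::
  "('n::finite \<times> 'n) set \<Rightarrow> real \<Rightarrow> real \<Rightarrow> (('n \<times> 'n) set \<Rightarrow> real ^ 'n ^ 'n) \<Rightarrow>
    real ^ 'n \<Rightarrow> 'n \<Rightarrow> 'n \<Rightarrow> bool" where
  "asymptotically_connected E R \<rho> P x0 i j \<longleftrightarrow> (i, j) \<in> (edges_infinity E R \<rho> P x0)\<^sup>*"

definition fast_convergence ::
  "('n::finite \<times> 'n) set \<Rightarrow> real \<Rightarrow> real \<Rightarrow> (('n \<times> 'n) set \<Rightarrow> real ^ 'n ^ 'n) \<Rightarrow>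
    real ^ 'n \<Rightarrow> bool" where
  "fast_convergence E R \<rho> P x0 \<longleftrightarrow>
    (\<exists>\<rho>'. \<rho>' < \<rho> \<and> (\<exists>M\<ge>0. \<forall>i t.
      \<bar>opinion E R \<rho> P x0 t $ i - opinion_limit E R \<rho> P x0 i\<bar> \<le> M * \<rho>' ^ t))"

text \<open>
  The operator \<open>lim\<close> is unspecified on divergent sequences. This does no harm below: the
  bound in \<open>fast_convergence\<close> by itself forces convergence to \<open>opinion_limit\<close>, also when the
  rate \<open>\<rho>'\<close> is negative (then the bound at \<open>t = 1\<close> gives \<open>M = 0\<close>).
\<close>

lemma fast_convergence_imp_tendsto:
  assumes "fast_convergence E R \<rho> P x0" and "\<rho> < 1"
  shows "(\<lambda>t. opinion E R \<rho> P x0 t $ i) \<longlonglongrightarrow> opinion_limit E R \<rho> P x0 i"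
proof -
  obtain \<rho>' M where r: "\<rho>' < \<rho>" and M: "M \<ge> 0"
    and bound: "\<And>t. \<bar>opinion E R \<rho> P x0 t $ i - opinion_limit E R \<rho> P x0 i\<bar> \<le> M * \<rho>' ^ t"
    using assms(1) unfolding fast_convergence_def by blast
  have "(\<lambda>t. M * \<rho>' ^ t) \<longlonglongrightarrow> 0"
  proof (cases "\<rho>' < 0")
    case True
    have "0 \<le> M * \<rho>'" using bound[of 1] by simp
    with True M have "M = 0" by (simp add: zero_le_mult_iff)
    then show ?thesis by simp
  next
    case False
    then have "(\<lambda>t. \<rho>' ^ t) \<longlonglongrightarrow> 0" using r assms(2) by (intro LIMSEQ_realpow_zero) auto
    then show ?thesis by (rule tendsto_mult_right_zero)
  qed
  then have "(\<lambda>t. opinion E R \<rho> P x0 t $ i - opinion_limit E R \<rho> P x0 i) \<longlonglongrightarrow> 0"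
    by (rule Lim_null_comparison[rotated]) (use bound in auto)
  then show ?thesis by (rule LIM_zero_cancel)
qed

end

theory Submission imports Defs begin

text \<open>
  Under fast convergence, the interaction graph is eventually constant. If two neighbours in
  \<open>E\<close> agree asymptotically, their distance decays like the power of a rate below \<open>\<rho>\<close>, so it
  eventually stays below the threshold \<open>R * \<rho> ^ t\<close>; if they disagree, their distance eventually
  exceeds that threshold. Hence the edges that occur infinitely often are exactly those
  whose ends agree, and these are present from some time on
  (\<open>edges_at_eventually_edges_infinity\<close>).

  From some time \<open>T\<close> on, the trajectory is therefore obtained by iterating one matrix \<open>P G\<close>, with
  \<open>G = edges_infinity\<close>, starting at \<open>Q *v x0\<close>, where \<open>Q\<close> is one of countably many products of
  matrices \<open>P G'\<close>. For agents \<open>i\<close>, \<open>j\<close> in different components of \<open>G\<close>, the initial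
  vectors whose iterates at \<open>i\<close> and \<open>j\<close> become asymptotically equal form a linear subspace. That
  subspace is proper: \<open>P G\<close> fixes the indicator vector of the component of \<open>i\<close>, which
  separates \<open>i\<close> from \<open>j\<close>, and this vector is \<open>Q *v x0\<close> for some \<open>x0\<close> because \<open>Q\<close> is
  invertible. So agreement of unconnected agents confines \<open>x0\<close> to a countable union of
  proper subspaces, which is a null set (\<open>AE_unconnected_separated\<close>).
\<close>

section \<open>Eventual constancy of the interaction graph\<close>

lemma interaction_edges_in_spanning_subgraphs:
  assumes "sym E"
  shows "interaction_edges E R \<rho> t y \<in> spanning_subgraphs E"
  using assms
  by (auto simp: spanning_subgraphs_def interaction_edges_def sym_def abs_minus_commute)

lemma fast_convergence_imp_smallo:
  assumes "fast_convergence E R \<rho> P x0" and "0 < \<rho>"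
  shows "(\<lambda>t. \<bar>opinion E R \<rho> P x0 t $ i - opinion_limit E R \<rho> P x0 i\<bar> / \<rho> ^ t) \<longlonglongrightarrow> 0"
proof -
  obtain \<rho>' M where r: "\<rho>' < \<rho>" and M: "M \<ge> 0"
    and bound: "\<And>t. \<bar>opinion E R \<rho> P x0 t $ i - opinion_limit E R \<rho> P x0 i\<bar> \<le> M * \<rho>' ^ t"
    using assms(1) unfolding fast_convergence_def by blast
  have "(\<lambda>t. M * (\<rho>' / \<rho>) ^ t) \<longlonglongrightarrow> 0"
  proof (cases "\<rho>' < 0")
    case True
    \<comment> \<open>A negative rate may exceed \<open>\<rho>\<close> in modulus, but the bound at time 1 then forces \<open>M = 0\<close>.\<close>
    have "0 \<le> M * \<rho>'" using bound[of 1] by simp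
    with True M have "M = 0" by (simp add: zero_le_mult_iff)
    then show ?thesis by simp
  next
    case False
    then have "(\<lambda>t. (\<rho>' / \<rho>) ^ t) \<longlonglongrightarrow> 0"
      using r assms(2) by (intro LIMSEQ_realpow_zero) auto
    then show ?thesis by (rule tendsto_mult_right_zero)
  qed
  then show ?thesis
  proof (rule Lim_null_comparison[rotated], intro always_eventually allI)
    fix t
    show "norm (\<bar>opinion E R \<rho> P x0 t $ i - opinion_limit E R \<rho> P x0 i\<bar> / \<rho> ^ t)
        \<le> M * (\<rho>' / \<rho>) ^ t"
      using bound[of t] assms(2) by (simp add: power_divide divide_right_mono)
  qed
qed

lemma agreeing_neighbours_eventually_interact:
  assumes fast: "fast_convergence E R \<rho> P x0" and "0 < \<rho>" and "R > 0"
    and "(i, j) \<in> E" and agree: "asymptotically_agree E R \<rho> P x0 i j"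
  shows "\<forall>\<^sub>F t in sequentially. (i, j) \<in> edges_at E R \<rho> P x0 t"
proof -
  let ?x = "opinion E R \<rho> P x0" and ?l = "opinion_limit E R \<rho> P x0"
  have "(\<lambda>t. \<bar>?x t $ i - ?l i\<bar> / \<rho> ^ t + \<bar>?x t $ j - ?l j\<bar> / \<rho> ^ t) \<longlonglongrightarrow> 0 + 0"
    by (intro tendsto_add fast_convergence_imp_smallo fast \<open>0 < \<rho>\<close>)
  then have "\<forall>\<^sub>F t in sequentially. \<bar>?x t $ i - ?l i\<bar> / \<rho> ^ t + \<bar>?x t $ j - ?l j\<bar> / \<rho> ^ t < R"
    by (rule order_tendstoD) (use \<open>R > 0\<close> in simp)
  then show ?thesis
  proof eventually_elim
    case (elim t)
    then have "\<bar>?x t $ i - ?l i\<bar> + \<bar>?x t $ j - ?l j\<bar> < R * \<rho> ^ t"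
      using \<open>0 < \<rho>\<close> by (simp add: field_simps)
    moreover have "?l i = ?l j"
      using agree by (simp add: asymptotically_agree_def)
    ultimately show ?case
      using \<open>(i, j) \<in> E\<close> by (simp add: edges_at_def interaction_edges_def)
  qed
qed

text \<open>
  At the infinitely many times at which \<open>i\<close> and \<open>j\<close> interact, their distance is at most
  \<open>R * \<rho> ^ t\<close>, which tends to 0.
\<close>

lemma edges_infinity_imp_agree:
  assumes fast: "fast_convergence E R \<rho> P x0" and "0 < \<rho>" and "\<rho> < 1"
    and edge: "(i, j) \<in> edges_infinity E R \<rho> P x0"
  shows "asymptotically_agree E R \<rho> P x0 i j"
proof (rule ccontr)
  let ?x = "opinion E R \<rho> P x0" and ?l = "opinion_limit E R \<rho> P x0"
  assume "\<not> asymptotically_agree E R \<rho> P x0 i j"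
  then have "0 < \<bar>?l i - ?l j\<bar> - R * 0" by (simp add: asymptotically_agree_def)
  moreover have "(\<lambda>t. \<bar>?x t $ i - ?x t $ j\<bar> - R * \<rho> ^ t) \<longlonglongrightarrow> \<bar>?l i - ?l j\<bar> - R * 0"
    using assms(2,3)
    by (intro tendsto_intros fast_convergence_imp_tendsto[OF fast] LIMSEQ_realpow_zero) auto
  ultimately have "\<forall>\<^sub>F t in sequentially. 0 < \<bar>?x t $ i - ?x t $ j\<bar> - R * \<rho> ^ t"
    by (rule order_tendstoD[rotated])
  then obtain T where T: "\<And>t. t \<ge> T \<Longrightarrow> R * \<rho> ^ t < \<bar>?x t $ i - ?x t $ j\<bar>"
    by (auto simp: eventually_sequentially)
  obtain s where "s \<ge> T" and "(i, j) \<in> edges_at E R \<rho> P x0 s"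
    using edge unfolding edges_infinity_def by blast
  with T[of s] show False by (simp add: edges_at_def interaction_edges_def)
qed

lemma asymptotically_connected_imp_agree:
  assumes fast: "fast_convergence E R \<rho> P x0" and "0 < \<rho>" and "\<rho> < 1"
    and "asymptotically_connected E R \<rho> P x0 i j"
  shows "asymptotically_agree E R \<rho> P x0 i j"
  using assms(4) unfolding asymptotically_connected_def
proof (induction rule: rtrancl_induct)
  case base
  show ?case by (simp add: asymptotically_agree_def)
next
  case (step k l)
  with edges_infinity_imp_agree[OF assms(1-3)] show ?case
    by (force simp: asymptotically_agree_def)
qed

text \<open>
  An edge of \<open>edges_infinity\<close> joins agreeing agents and is therefore present from some time on;
  any other edge occurs only finitely often. There are finitely many pairs, so one time serves
  them all.
\<close>

lemma edges_at_eventually_edges_infinity: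
  fixes E :: "('n::finite \<times> 'n) set"
  assumes fast: "fast_convergence E R \<rho> P x0" and "0 < \<rho>" and "\<rho> < 1" and "R > 0"
  shows "\<forall>\<^sub>F t in sequentially. edges_at E R \<rho> P x0 t = edges_infinity E R \<rho> P x0"
proof -
  have "\<forall>\<^sub>F t in sequentially.
      (i, j) \<in> edges_at E R \<rho> P x0 t \<longleftrightarrow> (i, j) \<in> edges_infinity E R \<rho> P x0" for i j
  proof (cases "(i, j) \<in> edges_infinity E R \<rho> P x0")
    case True
    then have "(i, j) \<in> E" by (simp add: edges_infinity_def)
    then have "\<forall>\<^sub>F t in sequentially. (i, j) \<in> edges_at E R \<rho> P x0 t"
      by (intro agreeing_neighbours_eventually_interact[OF fast \<open>0 < \<rho>\<close> \<open>R > 0\<close>]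
          edges_infinity_imp_agree[OF fast \<open>0 < \<rho>\<close> \<open>\<rho> < 1\<close> True])
    with True show ?thesis by simp
  next
    case False
    have "(i, j) \<in> E" if "(i, j) \<in> edges_at E R \<rho> P x0 t" for t
      using that by (simp add: edges_at_def interaction_edges_def)
    with False have "\<forall>\<^sub>F t in sequentially. (i, j) \<notin> edges_at E R \<rho> P x0 t"
      by (auto simp: edges_infinity_def eventually_sequentially)
    with False show ?thesis by simp
  qed
  then have "\<forall>\<^sub>F t in sequentially. \<forall>e. e \<in> edges_at E R \<rho> P x0 t \<longleftrightarrow> e \<in> edges_infinity E R \<rho> P x0"
    by (intro eventually_all_finite) (auto simp: split_paired_all)
  then show ?thesis by eventually_elim blast
qed

section \<open>The trajectory as a product of matrices\<close>

text \<open>The head of the list is the most recent graph, so that a time step prepends to the list.\<close>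

primrec word_matrix :: "('g \<Rightarrow> real ^ 'n ^ 'n) \<Rightarrow> 'g list \<Rightarrow> real ^ 'n::finite ^ 'n" where
  "word_matrix P [] = mat 1"
| "word_matrix P (G # Gs) = P G ** word_matrix P Gs"

lemma invertible_word_matrix:
  assumes "\<And>G. G \<in> set Gs \<Longrightarrow> invertible (P G)"
  shows "invertible (word_matrix P Gs)"
  using assms
proof (induction Gs)
  case Nil
  show ?case by (auto simp: invertible_def intro: exI[of _ "mat 1"])
qed (auto intro: invertible_mult)

lemma opinion_eq_word_matrix:
  assumes "sym E"
  obtains Gs where "set Gs \<subseteq> spanning_subgraphs E"
    and "opinion E R \<rho> P x0 t = word_matrix P Gs *v x0"
proof -
  have "\<exists>Gs. set Gs \<subseteq> spanning_subgraphs E \<and> opinion E R \<rho> P x0 t = word_matrix P Gs *v x0"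
  proof (induction t)
    case 0
    show ?case by (rule exI[of _ "[]"]) simp
  next
    case (Suc t)
    then obtain Gs where "set Gs \<subseteq> spanning_subgraphs E"
      and "opinion E R \<rho> P x0 t = word_matrix P Gs *v x0" by blast
    then show ?case
      by (intro exI[of _ "interaction_edges E R \<rho> t (opinion E R \<rho> P x0 t) # Gs"])
        (simp add: matrix_vector_mul_assoc interaction_edges_in_spanning_subgraphs[OF assms])
  qed
  then show thesis using that by blast
qed

lemma opinion_constant_edges:
  assumes "\<And>t. t \<ge> T \<Longrightarrow> edges_at E R \<rho> P x0 t = G"
  shows "opinion E R \<rho> P x0 (T + s) = ((*v) (P G) ^^ s) (opinion E R \<rho> P x0 T)"
proof (induction s)
  case (Suc s)
  have "interaction_edges E R \<rho> (T + s) (opinion E R \<rho> P x0 (T + s)) = G"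
    using assms[of "T + s"] by (simp add: edges_at_def)
  then show ?case by (simp add: Suc.IH)
qed simp

section \<open>Unconnected agents almost never agree\<close>

lemma linear_funpow:
  fixes f :: "'a::real_vector \<Rightarrow> 'a"
  assumes "linear f"
  shows "linear (f ^^ s)"
proof (induction s)
  case 0
  show ?case using linear_id by (simp add: id_def)
next
  case (Suc s)
  then show ?case using linear_compose[OF Suc assms] by (simp add: o_def)
qed

lemma subspace_tendsto_zero:
  fixes f :: "nat \<Rightarrow> 'a::real_vector \<Rightarrow> real"
  assumes "\<And>s. linear (f s)"
  shows "subspace {x. (\<lambda>s. f s x) \<longlonglongrightarrow> 0}"
  by (auto simp: subspace_def linear_0[OF assms] linear_add[OF assms] linear_scale[OF assms]
      intro: tendsto_add_zero tendsto_mult_right_zero)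

lemma negligible_proper_subspace:
  fixes S :: "'a::euclidean_space set"
  assumes "subspace S" and "x \<notin> S"
  shows "negligible S"
proof (rule negligible_lowdim)
  have "span S \<noteq> UNIV" using assms by (auto simp: span_eq_iff[THEN iffD2])
  then show "dim S < DIM('a)"
    using dim_eq_full[of S] dim_subset_UNIV[of S] by linarith
qed

text \<open>
  By symmetry of \<open>G\<close>, row \<open>k\<close> of \<open>A\<close> lives entirely inside the component of \<open>i\<close> if \<open>k\<close> belongs
  to it, and entirely outside otherwise.
\<close>

lemma component_indicator_fixed:
  fixes A :: "real ^ 'n::finite ^ 'n" and i :: 'n
  assumes "sym G"
    and row: "\<And>k. (\<Sum>j\<in>UNIV. A $ k $ j) = 1"
    and supp: "\<And>k j. A $ k $ j \<noteq> 0 \<Longrightarrow> j = k \<or> (k, j) \<in> G"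
  defines "v \<equiv> (\<chi> k. of_bool ((i, k) \<in> G\<^sup>*))"
  shows "A *v v = v"
proof -
  have same: "(i, j) \<in> G\<^sup>* \<longleftrightarrow> (i, k) \<in> G\<^sup>*" if "A $ k $ j \<noteq> 0" for k j
    using supp[OF that] symD[OF \<open>sym G\<close>] by (blast intro: rtrancl.rtrancl_into_rtrancl)
  have "(\<Sum>j\<in>UNIV. A $ k $ j * v $ j) = (\<Sum>j\<in>UNIV. A $ k $ j * v $ k)" for k
    using same by (intro sum.cong refl) (auto simp: v_def)
  then show ?thesis
    by (simp add: vec_eq_iff matrix_vector_mult_def row flip: sum_distrib_right)
qed

text \<open>
  The set is a linear subspace, and the initial vector that \<open>Q\<close> maps to the indicator of the
  component of \<open>i\<close> lies outside it: the difference at \<open>i\<close> and \<open>j\<close> then equals 1 forever.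
\<close>

lemma negligible_unconnected_agree:
  fixes A Q :: "real ^ 'n::finite ^ 'n"
  assumes "sym G"
    and row: "\<And>k. (\<Sum>j\<in>UNIV. A $ k $ j) = 1"
    and supp: "\<And>k j. A $ k $ j \<noteq> 0 \<Longrightarrow> j = k \<or> (k, j) \<in> G"
    and "invertible Q" and "(i, j) \<notin> G\<^sup>*"
  shows "negligible {x. (\<lambda>s. ((*v) A ^^ s) (Q *v x) $ i - ((*v) A ^^ s) (Q *v x) $ j) \<longlonglongrightarrow> 0}"
    (is "negligible ?S")
proof -
  have "linear (\<lambda>x. ((*v) A ^^ s) (Q *v x))" for s
    using linear_compose[OF matrix_vector_mul_linear linear_funpow[OF matrix_vector_mul_linear]]
    by (simp add: o_def)
  then have "linear (\<lambda>x. ((*v) A ^^ s) (Q *v x) $ i - ((*v) A ^^ s) (Q *v x) $ j)" for s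
    by (auto simp: linear_iff algebra_simps)
  then have "subspace ?S" by (rule subspace_tendsto_zero)
  define v :: "real ^ 'n" where "v = (\<chi> k. of_bool ((i, k) \<in> G\<^sup>*))"
  have "A *v v = v"
    unfolding v_def using assms(1-3) by (rule component_indicator_fixed)
  then have fixed: "((*v) A ^^ s) v = v" for s by (induction s) auto
  obtain Q' where "Q ** Q' = mat 1"
    using \<open>invertible Q\<close> unfolding invertible_def by blast
  then have "Q *v (Q' *v v) = v"
    by (simp add: matrix_vector_mul_assoc)
  moreover have "v $ i - v $ j = 1"
    using \<open>(i, j) \<notin> G\<^sup>*\<close> by (simp add: v_def)
  ultimately have "Q' *v v \<notin> ?S"
    by (simp add: fixed LIMSEQ_const_iff)
  with \<open>subspace ?S\<close> show ?thesis by (rule negligible_proper_subspace)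
qed

text \<open>
  The exceptional subspaces are indexed by the finite history \<open>Gs\<close>, the final graph \<open>G\<close> and the
  pair \<open>i\<close>, \<open>j\<close>. Since \<open>G\<close> and the members of \<open>Gs\<close> range over a finite type, there are only
  countably many. The history is quantified instead of being read off the trajectory because the
  latter depends on \<open>x\<close> nonlinearly.
\<close>

lemma AE_unconnected_separated:
  fixes E :: "('n::finite \<times> 'n) set" and P :: "('n \<times> 'n) set \<Rightarrow> real ^ 'n ^ 'n"
  assumes row: "\<And>G i. G \<in> spanning_subgraphs E \<Longrightarrow> (\<Sum>j\<in>UNIV. P G $ i $ j) = 1"
    and supp: "\<And>G i j. G \<in> spanning_subgraphs E \<Longrightarrow> P G $ i $ j \<noteq> 0 \<Longrightarrow> j = i \<or> (i, j) \<in> G"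
    and inv: "\<And>G. G \<in> spanning_subgraphs E \<Longrightarrow> invertible (P G)"
  shows "AE x in lebesgue. \<forall>Gs G i j.
    set Gs \<subseteq> spanning_subgraphs E \<longrightarrow> G \<in> spanning_subgraphs E \<longrightarrow> (i, j) \<notin> G\<^sup>* \<longrightarrow>
    \<not> (\<lambda>s. ((*v) (P G) ^^ s) (word_matrix P Gs *v x) $ i
          - ((*v) (P G) ^^ s) (word_matrix P Gs *v x) $ j) \<longlonglongrightarrow> 0"
    (is "AE x in lebesgue. \<forall>Gs G i j. ?Gs Gs \<longrightarrow> ?G G \<longrightarrow> ?sep G i j \<longrightarrow> \<not> ?agree Gs G i j x")
  unfolding AE_all_countable
proof (intro allI)
  fix Gs G i j
  show "AE x in lebesgue. ?Gs Gs \<longrightarrow> ?G G \<longrightarrow> ?sep G i j \<longrightarrow> \<not> ?agree Gs G i j x"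
  proof (cases "?Gs Gs \<and> ?G G \<and> ?sep G i j")
    case True
    then have "sym G" by (simp add: spanning_subgraphs_def)
    moreover have "invertible (word_matrix P Gs)"
      using True inv by (intro invertible_word_matrix) blast
    ultimately have "negligible {x. ?agree Gs G i j x}"
      using True row supp by (intro negligible_unconnected_agree[where G = G]) auto
    then show ?thesis
      unfolding negligible_iff_null_sets by (rule AE_I') auto
  qed auto
qed

section \<open>Agreement and connectedness\<close>

theorem theorem2:
  fixes E :: "('n::finite \<times> 'n) set"
    and R \<rho> :: real
    and P :: "('n \<times> 'n) set \<Rightarrow> real ^ 'n ^ 'n"
  assumes "sym E" and "irrefl E"
    and "R > 0" and "0 < \<rho>" and "\<rho> < 1"
    and "\<And>E' i j. E' \<in> spanning_subgraphs E \<Longrightarrow> P E' $ i $ j \<in> {0..1}"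
    and "\<And>E' i. E' \<in> spanning_subgraphs E \<Longrightarrow> (\<Sum>j\<in>UNIV. P E' $ i $ j) = 1"
    and "\<And>E' i j. E' \<in> spanning_subgraphs E \<Longrightarrow> P E' $ i $ j \<noteq> 0 \<longleftrightarrow> j = i \<or> (i, j) \<in> E'"
    and "\<And>E'. E' \<in> spanning_subgraphs E \<Longrightarrow> invertible (P E')"
  shows "AE x0 in (lebesgue :: (real ^ 'n) measure).
    fast_convergence E R \<rho> P x0 \<longrightarrow>
      (\<forall>i j. asymptotically_agree E R \<rho> P x0 i j \<longleftrightarrow> asymptotically_connected E R \<rho> P x0 i j)"
proof (rule AE_unconnected_separated[where E = E and P = P, THEN eventually_mono])
  show "\<And>G i. G \<in> spanning_subgraphs E \<Longrightarrow> (\<Sum>j\<in>UNIV. P G $ i $ j) = 1"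
    by fact
  show "\<And>G i j. G \<in> spanning_subgraphs E \<Longrightarrow> P G $ i $ j \<noteq> 0 \<Longrightarrow> j = i \<or> (i, j) \<in> G"
    using assms(8) by blast
  show "\<And>G. G \<in> spanning_subgraphs E \<Longrightarrow> invertible (P G)"
    by fact
next
  fix x0
  assume separated: "\<forall>Gs G i j.
    set Gs \<subseteq> spanning_subgraphs E \<longrightarrow> G \<in> spanning_subgraphs E \<longrightarrow> (i, j) \<notin> G\<^sup>* \<longrightarrow>
    \<not> (\<lambda>s. ((*v) (P G) ^^ s) (word_matrix P Gs *v x0) $ i
          - ((*v) (P G) ^^ s) (word_matrix P Gs *v x0) $ j) \<longlonglongrightarrow> 0"
  let ?x = "opinion E R \<rho> P x0" and ?G = "edges_infinity E R \<rho> P x0"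
  show "fast_convergence E R \<rho> P x0 \<longrightarrow>
      (\<forall>i j. asymptotically_agree E R \<rho> P x0 i j \<longleftrightarrow> asymptotically_connected E R \<rho> P x0 i j)"
  proof (intro impI allI iffI)
    fix i j
    assume fast: "fast_convergence E R \<rho> P x0"
    show "asymptotically_agree E R \<rho> P x0 i j" if "asymptotically_connected E R \<rho> P x0 i j"
      using asymptotically_connected_imp_agree[OF fast \<open>0 < \<rho>\<close> \<open>\<rho> < 1\<close> that] .
    assume agree: "asymptotically_agree E R \<rho> P x0 i j"
    obtain T where T: "\<And>t. t \<ge> T \<Longrightarrow> edges_at E R \<rho> P x0 t = ?G"
      using edges_at_eventually_edges_infinity[OF fast \<open>0 < \<rho>\<close> \<open>\<rho> < 1\<close> \<open>R > 0\<close>]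
      by (auto simp: eventually_sequentially)
    then have G: "?G \<in> spanning_subgraphs E"
      using interaction_edges_in_spanning_subgraphs[OF \<open>sym E\<close>] T[of T]
      by (metis edges_at_def order_refl)
    obtain Gs where Gs: "set Gs \<subseteq> spanning_subgraphs E"
      and xT: "?x T = word_matrix P Gs *v x0"
      using opinion_eq_word_matrix[OF \<open>sym E\<close>] .
    have "(\<lambda>t. ?x t $ i - ?x t $ j) \<longlonglongrightarrow> 0"
      using tendsto_diff[OF fast_convergence_imp_tendsto[OF fast \<open>\<rho> < 1\<close>, of i]
          fast_convergence_imp_tendsto[OF fast \<open>\<rho> < 1\<close>, of j]] agree
      by (simp add: asymptotically_agree_def)
    then have "(\<lambda>s. ?x (T + s) $ i - ?x (T + s) $ j) \<longlonglongrightarrow> 0"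
      using LIMSEQ_ignore_initial_segment[of _ 0 T] by (simp add: add.commute)
    then have "(i, j) \<in> ?G\<^sup>*"
      using separated G Gs by (auto simp: opinion_constant_edges[OF T] xT)
    then show "asymptotically_connected E R \<rho> P x0 i j"
      by (simp add: asymptotically_connected_def)
  qed
qed

end
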